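(* For almost every $\bm{a}=(a_p)_p\in\Omega$, there exists a set $S\subset[0,1]$ of full Lebesgue measure such that, for any real $c$ with $0<c<1/2$ and any $x\in S$, $$\Bigl|\Bigl\{p\leq X \text{ prime} : \bigl|x-\tfrac{a_p}{p}\bigr|\leq\tfrac{c}{p}\Bigr\}\Bigr|\sim 2c\log\log X\qquad\text{as } X\to\infty.$$
   Context: The index $p$ runs over prime numbers. $\Omega=\{(a_p)_p : a_p\in\mathbf{Z},\ 0\leq a_p<p \text{ for all primes } p\}$, endowed with the product probability measure for which the coordinates $a_p$ are independent and each $a_p$ is uniformly distributed in $\{0,\ldots,p-1\}$; "almost every $\bm{a}\in\Omega$" refers to this measure. *)

theory Defs
  imports "HOL-Probability.Probability" "HOL-Library.Landau_Symbols"
    "HOL-Computational_Algebra.Primes"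
begin

definition Omega_measure :: "(nat \<Rightarrow> int) measure" where
  "Omega_measure = PiM {p. prime p} (\<lambda>p. uniform_count_measure {0..<int p})"

text \<open>A tuple in Omega is encoded as a function on \<^typ>\<open>nat\<close> that takes the value
  \<^const>\<open>undefined\<close> off the primes.\<close>

lemma space_Omega_measure:
  "space Omega_measure = (\<Pi>\<^sub>E p\<in>{p. prime p}. {0..<int p})"
  by (simp add: Omega_measure_def space_PiM space_uniform_count_measure)

lemma prob_space_Omega_measure: "prob_space Omega_measure"
  unfolding Omega_measure_def
  by (rule prob_space_PiM, rule prob_space_uniform_count_measure)
     (auto simp: prime_gt_0_nat)

end

theory Submission
  imports Defs "HOL-Computational_Algebra.Squarefree" "HOL-Real_Asymp.Real_Asymp"
begin

text \<open>
  Draw \<open>x\<close> uniformly from the unit interval, independently of \<open>a\<close>, and let \<open>E\<^sub>p\<close> be the event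
  that \<open>x\<close> lies within \<open>c / p\<close> of \<open>a\<^sub>p / p\<close>. Then \<open>P(E\<^sub>p) = 2c/p + O(1/p\<^sup>2)\<close>, and counting
  the intervals around the points \<open>u / p\<close> that meet a given interval around \<open>v / q\<close> gives
  \<open>P(E\<^sub>p \<inter> E\<^sub>q) \<le> 4c\<^sup>2/(pq) + 2/p\<^sup>2\<close> for \<open>q < p\<close>. Hence the number of \<open>p \<le> X\<close> for which \<open>E\<^sub>p\<close>
  occurs has mean square deviation \<open>O(L)\<close> from \<open>2 c L\<close>, where \<open>L\<close> is the sum of \<open>1 / p\<close> over
  \<open>p \<le> X\<close>. Since \<open>L\<close> is asymptotic to \<open>ln (ln X)\<close>, these deviations divided by \<open>k\<^sup>2\<close> are square
  summable along \<open>X = exp (exp (k\<^sup>2))\<close>, which gives almost sure convergence there, and monotonicity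
  in \<open>X\<close> fills the gaps. Monotonicity in \<open>c\<close> reduces all \<open>c\<close> to the countably many rational ones,
  and Fubini's theorem separates \<open>a\<close> from \<open>x\<close>.

  The asymptotics of \<open>L\<close> does not need Mertens' theorem. From above, multiplying out the product of
  \<open>1 + p powr -(1 + s)\<close> bounds the sum of \<open>p powr -(1 + s)\<close> by \<open>ln (1 + 1/s) + O(1)\<close>, and one takes
  \<open>s = \<epsilon> / ln X\<close>, where \<open>\<epsilon>\<close> tends to \<open>0\<close> slowly; from below, every integer is a squarefree number
  times a square.
\<close>

subsection \<open>The sum of the reciprocals of the primes\<close>

text \<open>The prime factors of a product of distinct primes are these primes, so
  \<open>prime_factors\<close> is a left inverse.\<close>

lemma inj_on_Prod_primes: "inj_on (\<lambda>S. \<Prod>S) (Pow P)"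
  if "finite P" "\<And>p. p \<in> P \<Longrightarrow> prime p" for P :: "nat set"
proof -
  have "prime_factors (\<Prod>S) = S" if "S \<subseteq> P" for S
  proof -
    from that have S: "finite S" "\<And>p. p \<in> S \<Longrightarrow> prime p"
      using \<open>finite P\<close> \<open>\<And>p. p \<in> P \<Longrightarrow> prime p\<close> by (auto intro: finite_subset)
    have "0 \<notin> S" using S(2)[of 0] by auto
    then have "prime_factors (\<Prod>S) = (\<Union>p\<in>S. prime_factors p)"
      using prime_factors_prod[of S "\<lambda>p. p"] S(1) by (simp add: comp_def)
    also have "\<dots> = (\<Union>p\<in>S. {p})"
      using S(2) by (intro SUP_cong) (auto simp: prime_prime_factors)
    finally show ?thesis by simp
  qed
  then show ?thesis by (intro inj_on_inverseI[of _ prime_factors]) auto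
qed

text \<open>Multiplying out gives one term \<open>n powr - a\<close> for each product
  \<open>n\<close> of a subset of \<open>P\<close>. By unique factorisation these \<open>n\<close>
  are distinct, and as positive divisors of \<open>\<Prod>P\<close> they lie between 1 and
  \<open>\<Prod>P\<close>.\<close>

lemma prod_one_add_primes_le:
  fixes P :: "nat set"
  assumes "finite P" "\<And>p. p \<in> P \<Longrightarrow> prime p"
  shows "(\<Prod>p\<in>P. 1 + real p powr - a) \<le> (\<Sum>n=1..\<Prod>P. real n powr - a)"
proof -
  have pos: "n > 0" if "n \<in> P" for n using assms(2)[OF that] by (rule prime_gt_0_nat)
  have "(\<Prod>p\<in>P. 1 + real p powr - a) = (\<Sum>S\<in>Pow P. \<Prod>p\<in>S. real p powr - a)"
    using prod_add[OF assms(1), of "\<lambda>p. real p powr - a" "\<lambda>_. 1"] by (simp add: add.commute)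
  also have "\<dots> = (\<Sum>S\<in>Pow P. real (\<Prod>S) powr - a)"
    by (intro sum.cong refl) (simp add: prod_powr_distrib of_nat_prod)
  also have "\<dots> = (\<Sum>n\<in>(\<lambda>S. \<Prod>S) ` Pow P. real n powr - a)"
    using inj_on_Prod_primes[OF assms] by (subst sum.reindex) auto
  also have "\<dots> \<le> (\<Sum>n=1..\<Prod>P. real n powr - a)"
  proof (intro sum_mono2)
    show "(\<lambda>S. \<Prod>S) ` Pow P \<subseteq> {1..\<Prod>P}"
    proof safe
      fix S assume S: "S \<subseteq> P"
      have "\<Prod>S > 0" using S pos by (intro prod_pos) auto
      moreover have "\<Prod>S \<le> \<Prod>P"
        by (rule dvd_imp_le) (use S pos assms(1) in \<open>auto intro!: prod_dvd_prod_subset prod_pos\<close>)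
      ultimately show "\<Prod>S \<in> {1..\<Prod>P}" by simp
    qed
  qed auto
  finally show ?thesis .
qed

lemma sum_powr_le:
  fixes s :: real
  assumes "s > 0"
  shows "(\<Sum>n=1..N. real n powr - (1 + s)) \<le> 1 + 1 / s"
proof -
  \<comment> \<open>The subtracted term is the integral of \<open>t powr - (1 + s)\<close> over
    \<open>t\<close> from \<open>Suc M\<close> to infinity; with it the bound can be proved by
    induction.\<close>
  have "(\<Sum>n=1..Suc M. real n powr - (1 + s)) \<le> 1 + 1 / s - real (Suc M) powr - s / s" for M
  proof (induction M)
    case (Suc M)
    let ?y = "real (Suc (Suc M))"
    have y: "?y > 1" by simp
    \<comment> \<open>This is Bernoulli's inequality for the exponent \<open>- s\<close>. Multiplied
      by \<open>?y powr - s\<close>, it bounds the new term by the integral from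
      \<open>?y - 1\<close> to \<open>?y\<close>.\<close>
    have "1 + s * (1 / ?y) \<le> exp (s * (1 / ?y))" by (rule exp_ge_add_one_self)
    also have "\<dots> \<le> exp (s * - ln (1 - 1 / ?y))"
    proof -
      have "ln (1 - 1 / ?y) \<le> (1 - 1 / ?y) - 1"
        using y by (intro ln_le_minus_one) simp
      then have "s * (1 / ?y) \<le> s * - ln (1 - 1 / ?y)"
        using assms by (intro mult_left_mono) linarith+
      then show ?thesis by (simp only: exp_le_cancel_iff)
    qed
    also have "\<dots> = (1 - 1 / ?y) powr - s"
      using y by (simp add: powr_def)
    finally have "?y powr - s * (1 + s * (1 / ?y)) \<le> ?y powr - s * (1 - 1 / ?y) powr - s"
      by (intro mult_left_mono) auto
    also have "\<dots> = (?y * (1 - 1 / ?y)) powr - s"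
      using y by (simp only: powr_mult)
    also have "?y * (1 - 1 / ?y) = real (Suc M)" using y by (simp add: field_simps)
    finally have "?y powr - s + s * (?y powr - s / ?y) \<le> real (Suc M) powr - s"
      by (simp add: algebra_simps)
    moreover have "?y powr - s / ?y = ?y powr - (1 + s)"
    proof -
      have "- (1 + s) = - s - 1" by simp
      then show ?thesis using y by (simp only: powr_diff) simp
    qed
    ultimately have "?y powr - (1 + s) \<le> (real (Suc M) powr - s - ?y powr - s) / s"
      using assms by (simp only: pos_le_divide_eq) (simp add: mult.commute)
    then show ?case using Suc.IH by (simp add: diff_divide_distrib)
  qed simp
  note * = this
  show ?thesis
  proof (cases N)
    case (Suc M)
    show ?thesis unfolding Suc using *[of M] assms
      by (smt (verit) divide_nonneg_pos powr_ge_zero)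
  qed (use assms in auto)
qed

lemma sum_inverse_squares_le: "(\<Sum>n\<in>A. 1 / real n ^ 2) \<le> 2" if "finite A"
proof -
  \<comment> \<open>The index 0 contributes 0, because division by zero yields 0.\<close>
  have "(\<Sum>n\<in>A. 1 / real n ^ 2) = (\<Sum>n\<in>A - {0}. 1 / real n ^ 2)"
    using that by (intro sum.mono_neutral_right) auto
  also have "\<dots> \<le> (\<Sum>n=1..Max (insert 0 A). 1 / real n ^ 2)"
    using that by (intro sum_mono2) (auto simp: Suc_le_eq)
  also have "\<dots> = (\<Sum>n=1..Max (insert 0 A). real n powr - (1 + 1))"
    by (intro sum.cong refl) (simp add: powr_minus powr_numeral divide_inverse)
  also have "\<dots> \<le> 2" using sum_powr_le[of 1] by simp
  finally show ?thesis .
qed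

definition prime_recip_sum :: "real \<Rightarrow> real" where
  "prime_recip_sum X = (\<Sum>p | prime p \<and> real p \<le> X. 1 / real p)"

lemma finite_primes_le: "finite {p::nat. prime p \<and> real p \<le> X}"
  by (rule finite_subset[of _ "{..nat \<lfloor>X\<rfloor>}"]) (auto simp: le_nat_iff le_floor_iff)

text \<open>The logarithm of the partial Euler product is a sum of terms \<open>ln (1 + t)\<close>
  with \<open>t = p powr - (1 + s)\<close>. Replacing \<open>t\<close> by \<open>ln (1 + t)\<close>
  costs at most \<open>t^2\<close>, hence at most \<open>1 / p^2\<close>, and these errors add up to
  at most 2.\<close>

lemma sum_prime_powr_le:
  fixes P :: "nat set"
  assumes P: "finite P" "\<And>p. p \<in> P \<Longrightarrow> prime p" and "s > 0"
  shows "(\<Sum>p\<in>P. real p powr - (1 + s)) \<le> ln (1 + 1 / s) + 2"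
proof -
  have "(\<Sum>p\<in>P. real p powr - (1 + s)) \<le> (\<Sum>p\<in>P. ln (1 + real p powr - (1 + s)) + 1 / real p ^ 2)"
  proof (rule sum_mono)
    fix p assume "p \<in> P"
    then have p: "real p \<ge> 1" using P(2)[of p] prime_gt_0_nat[of p] by (simp add: Suc_le_eq)
    define t where "t = real p powr - (1 + s)"
    have "t \<le> real p powr - 1" unfolding t_def using p assms by (intro powr_mono) auto
    then have t: "0 \<le> t" "t \<le> 1 / real p" using p by (auto simp: t_def powr_minus divide_inverse)
    then have "t \<le> 1" using p by (smt (verit) divide_le_eq_1)
    then have "t - t\<^sup>2 \<le> ln (1 + t)" using ln_one_plus_pos_lower_bound[of t] t by simp
    moreover have "t\<^sup>2 \<le> (1 / real p)\<^sup>2" using t by (intro power_mono) auto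
    ultimately show "t \<le> ln (1 + t) + 1 / real p ^ 2" by (simp add: power_divide)
  qed
  also have "\<dots> = ln (\<Prod>p\<in>P. 1 + real p powr - (1 + s)) + (\<Sum>p\<in>P. 1 / real p ^ 2)"
    using P(1) by (subst ln_prod) (auto simp: sum.distrib intro!: less_imp_neq[symmetric] add_pos_nonneg)
  also have "\<dots> \<le> ln (1 + 1 / s) + 2"
  proof (intro add_mono)
    have "(\<Prod>p\<in>P. 1 + real p powr - (1 + s)) \<le> 1 + 1 / s"
      using prod_one_add_primes_le[OF P, of "1 + s"] sum_powr_le[OF \<open>s > 0\<close>, of "\<Prod>P"] by linarith
    moreover have "(\<Prod>p\<in>P. 1 + real p powr - (1 + s)) > 0"
      by (intro prod_pos) (auto intro: add_pos_nonneg)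
    ultimately show "ln (\<Prod>p\<in>P. 1 + real p powr - (1 + s)) \<le> ln (1 + 1 / s)"
      by simp
  qed (use P sum_inverse_squares_le in auto)
  finally show ?thesis .
qed

text \<open>Rankin's trick: with \<open>s = \<epsilon> / ln X\<close> the weight
  \<open>exp \<epsilon> * p powr - s\<close> is at least 1 for every \<open>p \<le> X\<close>, so
  inserting it only increases the sum.\<close>

lemma prime_recip_sum_le:
  fixes X \<epsilon> :: real
  assumes "X > 1" "\<epsilon> > 0"
  shows "prime_recip_sum X \<le> exp \<epsilon> * (ln (1 + ln X / \<epsilon>) + 2)"
proof -
  let ?P = "{p::nat. prime p \<and> real p \<le> X}"
  define s where "s = \<epsilon> / ln X"
  have s: "s > 0" using assms by (simp add: s_def)
  have "prime_recip_sum X \<le> (\<Sum>p\<in>?P. exp \<epsilon> * real p powr - (1 + s))"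
    unfolding prime_recip_sum_def
  proof (rule sum_mono)
    fix p assume p: "p \<in> ?P"
    then have p0: "real p > 0" using prime_gt_0_nat[of p] by simp
    have "s * ln (real p) \<le> s * ln X" using p p0 s by (intro mult_left_mono) auto
    also have "\<dots> = \<epsilon>" using assms by (simp add: s_def)
    finally have "1 \<le> exp \<epsilon> * real p powr - s" using p0
      by (simp add: powr_def flip: exp_add)
    then have "1 / real p \<le> exp \<epsilon> * real p powr - s / real p"
      using p0 by (simp add: divide_right_mono)
    also have "\<dots> = exp \<epsilon> * real p powr - (1 + s)"
    proof -
      have "- (1 + s) = - s - 1" by simp
      then show ?thesis using p0 by (simp only: powr_diff) simp
    qed
    finally show "1 / real p \<le> exp \<epsilon> * real p powr - (1 + s)" .
  qed
  also have "\<dots> = exp \<epsilon> * (\<Sum>p\<in>?P. real p powr - (1 + s))" by (simp add: sum_distrib_left)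
  also have "\<dots> \<le> exp \<epsilon> * (ln (1 + 1 / s) + 2)"
    using s finite_primes_le by (intro mult_left_mono sum_prime_powr_le) auto
  finally show ?thesis by (simp add: s_def)
qed

text \<open>Write \<open>n\<close> as a squarefree number times \<open>m^2\<close>. The map
  \<open>?g\<close> records the prime set \<open>S\<close> of the squarefree factor together with
  \<open>m\<close>, and is injective. Letting \<open>S\<close> and \<open>m\<close> vary
  independently gives a product of two sums: the one over \<open>S\<close> is the expanded product
  over primes, the one over \<open>m\<close> is at most 2.\<close>

lemma harm_le_prod_primes:
  "(harm N :: real) \<le> 2 * (\<Prod>p | prime p \<and> p \<le> N. 1 + 1 / real p)"
proof -
  let ?P = "{p::nat. prime p \<and> p \<le> N}"
  let ?g = "\<lambda>n::nat. (prime_factors (squarefree_part n), square_part n)"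
  have fin: "finite ?P" by (rule finite_subset[of _ "{..N}"]) auto
  have Prod: "\<Prod>(prime_factors (squarefree_part n)) = squarefree_part n" for n :: nat
  proof -
    have "\<Prod>(prime_factors (squarefree_part n)) =
        (\<Prod>p\<in>prime_factors (squarefree_part n). p ^ multiplicity p (squarefree_part n))"
      using squarefree_factorial_semiring'[of "squarefree_part n"] by (intro prod.cong) simp_all
    then show ?thesis by (simp add: prod_prime_factors)
  qed
  have dec: "squarefree_part n * square_part n ^ 2 = n" for n :: nat
    using squarefree_decompose[of n] by simp
  have inj: "inj_on ?g {1..N}"
    by (rule inj_on_inverseI[of _ "\<lambda>(S, m). \<Prod>S * m ^ 2"]) (simp add: Prod dec)
  have "(harm N :: real) = (\<Sum>n=1..N. case ?g n of (S, m) \<Rightarrow> (\<Prod>p\<in>S. 1 / real p) * (1 / real m ^ 2))"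
    unfolding harm_def
  proof (intro sum.cong refl)
    fix n
    have "real n = real (\<Prod>(prime_factors (squarefree_part n))) * real (square_part n) ^ 2"
      unfolding Prod by (metis dec of_nat_mult of_nat_power)
    then show "inverse (of_nat n) = (case ?g n of (S, m) \<Rightarrow> (\<Prod>p\<in>S. 1 / real p) * (1 / real m ^ 2))"
      by (simp add: prod_dividef of_nat_prod inverse_eq_divide)
  qed
  also have "\<dots> = (\<Sum>(S, m)\<in>?g ` {1..N}. (\<Prod>p\<in>S. 1 / real p) * (1 / real m ^ 2))"
    using inj by (subst sum.reindex) (auto simp: case_prod_unfold)
  also have "\<dots> \<le> (\<Sum>(S, m)\<in>Pow ?P \<times> {1..N}. (\<Prod>p\<in>S. 1 / real p) * (1 / real m ^ 2))"
  proof (intro sum_mono2)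
    show "?g ` {1..N} \<subseteq> Pow ?P \<times> {1..N}"
    proof safe
      fix n p assume n: "n \<in> {1..N}"
      have d: "squarefree_part n dvd n" "square_part n dvd n"
        using squarefree_decompose[of n] by (metis dvd_triv_left, metis dec dvd_mult2 dvd_triv_right mult.commute power2_eq_square)
      then have le: "squarefree_part n \<le> N" "square_part n \<le> N"
        using n dvd_imp_le[OF d(1)] dvd_imp_le[OF d(2)] by auto
      have "square_part n \<noteq> 0" using n by simp
      then have "1 \<le> square_part n" by linarith
      then show "square_part n \<in> {1..N}" using le by (simp only: atLeastAtMost_iff)
      assume p: "p \<in> prime_factors (squarefree_part n)"
      then show "prime p" by auto
      from p have "p dvd squarefree_part n" by auto
      then have "p \<le> squarefree_part n" by (rule dvd_imp_le) (simp add: zero_less_iff_neq_zero)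
      then show "p \<le> N" using le by simp
    qed
  qed (use fin in \<open>auto intro!: mult_nonneg_nonneg prod_nonneg divide_nonneg_nonneg\<close>)
  also have "\<dots> = (\<Sum>S\<in>Pow ?P. \<Prod>p\<in>S. 1 / real p) * (\<Sum>m=1..N. 1 / real m ^ 2)"
    by (simp add: sum_product sum.cartesian_product)
  also have "(\<Sum>S\<in>Pow ?P. \<Prod>p\<in>S. 1 / real p) = (\<Prod>p\<in>?P. 1 + 1 / real p)"
    using prod_add[OF fin, of "\<lambda>p. 1 / real p" "\<lambda>_. 1"] by (simp add: add.commute)
  also have "\<dots> * (\<Sum>m=1..N. 1 / real m ^ 2) \<le> \<dots> * 2"
    by (intro mult_left_mono sum_inverse_squares_le prod_nonneg) auto
  finally show ?thesis by simp
qed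

text \<open>Since \<open>1 + 1 / p \<le> exp (1 / p)\<close>, the product over primes that dominates
  the harmonic sum is at most \<open>exp (prime_recip_sum X)\<close>. The term \<open>ln 2\<close>
  comes from the factor 2 in front of that product.\<close>

lemma prime_recip_sum_ge:
  fixes X :: real
  assumes "X > 1"
  shows "ln (ln X) - ln 2 \<le> prime_recip_sum X"
proof -
  define N where "N = nat \<lfloor>X\<rfloor>"
  have N: "real N \<le> X" "X \<le> real N + 1" using assms by (auto simp: N_def)
  have P: "{p. prime p \<and> p \<le> N} = {p::nat. prime p \<and> real p \<le> X}"
    using assms by (auto simp: N_def le_nat_iff le_floor_iff)
  have "ln X \<le> ln (real N + 1)" using assms N by simp
  also have "\<dots> \<le> harm N" using ln_le_harm[of N] by (simp add: add.commute)
  also have "\<dots> \<le> 2 * (\<Prod>p | prime p \<and> p \<le> N. 1 + 1 / real p)" by (rule harm_le_prod_primes)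
  also have "\<dots> \<le> 2 * (\<Prod>p | prime p \<and> p \<le> N. exp (1 / real p))"
    by (intro mult_left_mono prod_mono) (auto simp: exp_ge_add_one_self)
  also have "\<dots> = 2 * exp (prime_recip_sum X)"
    unfolding prime_recip_sum_def P by (subst exp_sum[OF finite_primes_le]) simp
  finally have "ln (ln X) \<le> ln (2 * exp (prime_recip_sum X))"
    using assms by (intro ln_mono) auto
  then show ?thesis by (simp add: ln_mult)
qed

lemma prime_recip_sum_asymp: "((\<lambda>X. prime_recip_sum X / ln (ln X)) \<longlongrightarrow> 1) at_top"
proof (rule tendsto_sandwich)
  have ev: "eventually (\<lambda>X::real. X > 1 \<and> ln (ln X) > 0) at_top"
    by (intro eventually_conj; real_asymp)
  show "eventually (\<lambda>X. (ln (ln X) - ln 2) / ln (ln X) \<le> prime_recip_sum X / ln (ln X)) at_top"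
    using ev by eventually_elim (auto intro!: divide_right_mono prime_recip_sum_ge)
  \<comment> \<open>The choice is \<open>\<epsilon> = 1 / ln (ln X)\<close>: it tends to 0, so
    \<open>exp \<epsilon>\<close> tends to 1, yet so slowly that
    \<open>ln (1 + ln X / \<epsilon>)\<close> is still asymptotic to
    \<open>ln (ln X)\<close>.\<close>
  show "eventually (\<lambda>X. prime_recip_sum X / ln (ln X) \<le>
      exp (1 / ln (ln X)) * (ln (1 + ln X / (1 / ln (ln X))) + 2) / ln (ln X)) at_top"
    using ev by eventually_elim (intro divide_right_mono prime_recip_sum_le, auto)
  show "((\<lambda>X::real. (ln (ln X) - ln 2) / ln (ln X)) \<longlongrightarrow> 1) at_top" by real_asymp
  show "((\<lambda>X::real. exp (1 / ln (ln X)) * (ln (1 + ln X / (1 / ln (ln X))) + 2) / ln (ln X)) \<longlongrightarrow> 1) at_top"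
    by real_asymp
qed

subsection \<open>Second moments and almost sure convergence\<close>

text \<open>The series of the squares has finite expectation, so it converges almost surely and its
  terms tend to 0.\<close>

lemma AE_tendsto_0_of_summable_second_moments:
  fixes Z :: "nat \<Rightarrow> 'a \<Rightarrow> real"
  assumes int: "\<And>k. integrable M (\<lambda>w. (Z k w)\<^sup>2)"
    and summ: "summable (\<lambda>k. \<integral>w. (Z k w)\<^sup>2 \<partial>M)"
  shows "AE w in M. (\<lambda>k. Z k w) \<longlonglongrightarrow> 0"
proof -
  have meas [measurable]: "(\<lambda>w. (Z k w)\<^sup>2) \<in> borel_measurable M" for k
    using int by (rule borel_measurable_integrable)
  have "(\<integral>\<^sup>+w. (\<Sum>k. ennreal ((Z k w)\<^sup>2)) \<partial>M) = (\<Sum>k. \<integral>\<^sup>+w. ennreal ((Z k w)\<^sup>2) \<partial>M)"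
    by (rule nn_integral_suminf) measurable
  also have "\<dots> = (\<Sum>k. ennreal (\<integral>w. (Z k w)\<^sup>2 \<partial>M))"
    by (intro suminf_cong nn_integral_eq_integral int) auto
  also have "\<dots> \<noteq> \<infinity>"
    using summ by (simp add: suminf_ennreal2)
  finally have "AE w in M. (\<Sum>k. ennreal ((Z k w)\<^sup>2)) \<noteq> \<infinity>"
    by (intro nn_integral_PInf_AE) measurable
  then show ?thesis
  proof eventually_elim
    case (elim w)
    then have "summable (\<lambda>k. (Z k w)\<^sup>2)"
      by (intro summable_suminf_not_top) auto
    then have "(\<lambda>k. (Z k w)\<^sup>2) \<longlonglongrightarrow> 0" by (rule summable_LIMSEQ_zero)
    then have "(\<lambda>k. sqrt ((Z k w)\<^sup>2)) \<longlonglongrightarrow> sqrt 0" by (rule tendsto_real_sqrt)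
    then show ?case by (simp add: tendsto_rabs_zero_iff)
  qed
qed

text \<open>At \<open>X = exp (exp (k^2))\<close> the denominator \<open>ln (ln X)\<close> equals
  \<open>k^2\<close>. Any large \<open>X\<close> lies between two consecutive such points;
  monotonicity of \<open>F\<close> then loses at most a factor \<open>(k + 1)^2 / k^2\<close>, which
  tends to 1.\<close>

lemma tendsto_ln_ln_of_subsequence:
  fixes F :: "real \<Rightarrow> real"
  assumes F: "mono F" "\<And>X. F X \<ge> 0"
    and lim: "(\<lambda>k. F (exp (exp (real k ^ 2))) / real k ^ 2) \<longlonglongrightarrow> L"
  shows "((\<lambda>X. F X / ln (ln X)) \<longlongrightarrow> L) at_top"
proof (rule tendsto_sandwich)
  define a where "a = (\<lambda>k. F (exp (exp (real k ^ 2))) / real k ^ 2)"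
  define \<kappa> where "\<kappa> X = nat \<lfloor>sqrt (ln (ln X))\<rfloor>" for X :: real
  have a: "a \<longlonglongrightarrow> L" unfolding a_def by (rule lim)
  have \<kappa>: "filterlim \<kappa> at_top at_top" unfolding \<kappa>_def
    by (rule filterlim_compose[OF filterlim_nat_sequentially], rule filterlim_compose[OF filterlim_floor_sequentially]) real_asymp
  \<comment> \<open>The bound \<open>ln (ln X) \<ge> 1\<close> ensures
    \<open>\<kappa> X \<ge> 1\<close>, so that \<open>\<kappa> X ^ 2\<close> may be cancelled and
    divided by.\<close>
  have ev: "eventually (\<lambda>X::real. X > 1 \<and> ln (ln X) \<ge> 1) at_top"
    by (intro eventually_conj; real_asymp)
  have bounds: "real (\<kappa> X) \<ge> 1" "real (\<kappa> X) ^ 2 \<le> ln (ln X)" "ln (ln X) \<le> real (Suc (\<kappa> X)) ^ 2"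
    "exp (exp (real (\<kappa> X) ^ 2)) \<le> X" "X \<le> exp (exp (real (Suc (\<kappa> X)) ^ 2))"
    if X: "X > 1 \<and> ln (ln X) \<ge> 1" for X
  proof -
    define t where "t = ln (ln X)"
    have t: "t \<ge> 1" and "X > 1" using X by (auto simp: t_def)
    then have "ln X > 0" by simp
    have Xt: "X = exp (exp t)" using \<open>X > 1\<close> \<open>ln X > 0\<close> by (simp add: t_def)
    have s: "sqrt t \<ge> 1" using t by simp
    have k: "real (\<kappa> X) \<le> sqrt t" "sqrt t \<le> real (Suc (\<kappa> X))"
    proof -
      have "real (\<kappa> X) = of_int \<lfloor>sqrt t\<rfloor>" using s by (simp add: \<kappa>_def t_def[symmetric])
      then show "real (\<kappa> X) \<le> sqrt t" "sqrt t \<le> real (Suc (\<kappa> X))" by linarith+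
    qed
    have "\<lfloor>sqrt t\<rfloor> \<ge> 1" using s by simp
    then show "real (\<kappa> X) \<ge> 1" by (simp add: \<kappa>_def t_def[symmetric] le_nat_iff)
    have 1: "real (\<kappa> X) ^ 2 \<le> t"
      using power_mono[OF k(1), of 2] t by simp
    have 2: "t \<le> real (Suc (\<kappa> X)) ^ 2"
      using power_mono[OF k(2), of 2] t by simp
    show "real (\<kappa> X) ^ 2 \<le> ln (ln X)" "ln (ln X) \<le> real (Suc (\<kappa> X)) ^ 2"
      using 1 2 by (auto simp: t_def)
    show "exp (exp (real (\<kappa> X) ^ 2)) \<le> X" "X \<le> exp (exp (real (Suc (\<kappa> X)) ^ 2))"
    proof -
      have "exp (exp (real (\<kappa> X) ^ 2)) \<le> exp (exp t)" "exp (exp t) \<le> exp (exp (real (Suc (\<kappa> X)) ^ 2))"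
        using 1 2 by simp_all
      then show "exp (exp (real (\<kappa> X) ^ 2)) \<le> X" "X \<le> exp (exp (real (Suc (\<kappa> X)) ^ 2))"
        by (simp_all only: Xt[symmetric])
    qed
  qed
  show "eventually (\<lambda>X. a (\<kappa> X) * (real (\<kappa> X) ^ 2 / real (Suc (\<kappa> X)) ^ 2) \<le> F X / ln (ln X)) at_top"
    using ev
  proof eventually_elim
    case (elim X)
    note b = bounds[OF elim]
    have "a (\<kappa> X) * (real (\<kappa> X) ^ 2 / real (Suc (\<kappa> X)) ^ 2) =
        F (exp (exp (real (\<kappa> X) ^ 2))) / real (Suc (\<kappa> X)) ^ 2"
      using b(1) by (simp add: a_def)
    also have "\<dots> \<le> F X / ln (ln X)"
      by (intro frac_le F(2) monoD[OF F(1)] b(3,4)) (use elim in linarith)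
    finally show ?case .
  qed
  show "eventually (\<lambda>X. F X / ln (ln X) \<le> a (Suc (\<kappa> X)) * (real (Suc (\<kappa> X)) ^ 2 / real (\<kappa> X) ^ 2)) at_top"
    using ev
  proof eventually_elim
    case (elim X)
    note b = bounds[OF elim]
    have "F X / ln (ln X) \<le> F (exp (exp (real (Suc (\<kappa> X)) ^ 2))) / real (\<kappa> X) ^ 2"
      using b F by (intro frac_le monoD[OF F(1)]) auto
    also have "\<dots> = a (Suc (\<kappa> X)) * (real (Suc (\<kappa> X)) ^ 2 / real (\<kappa> X) ^ 2)"
      by (simp add: a_def)
    finally show ?case .
  qed
  have "(\<lambda>k. a k * (real k ^ 2 / real (Suc k) ^ 2)) \<longlonglongrightarrow> L * 1"
    by (intro tendsto_mult a) real_asymp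
  from filterlim_compose[OF this \<kappa>]
  show "((\<lambda>X. a (\<kappa> X) * (real (\<kappa> X) ^ 2 / real (Suc (\<kappa> X)) ^ 2)) \<longlongrightarrow> L) at_top" by simp
  have "(\<lambda>k. a (Suc k) * (real (Suc k) ^ 2 / real k ^ 2)) \<longlonglongrightarrow> L * 1"
    by (intro tendsto_mult filterlim_compose[OF a filterlim_Suc]) real_asymp
  from filterlim_compose[OF this \<kappa>]
  show "((\<lambda>X. a (Suc (\<kappa> X)) * (real (Suc (\<kappa> X)) ^ 2 / real (\<kappa> X) ^ 2)) \<longlongrightarrow> L) at_top" by simp
qed

text \<open>With \<open>T\<close> the count and \<open>m = 2 * c * L\<close>, the second moment is
  \<open>E(T^2) - 2 * m * E(T) + m^2\<close>. The terms of size \<open>m^2\<close> cancel. What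
  remains is \<open>5 * L\<close> from the pairs and \<open>4 * m \<le> 4 * L\<close> from the bound
  \<open>E(T) \<ge> m - 2\<close>.\<close>

lemma (in prob_space) second_moment_count_le:
  fixes E :: "nat \<Rightarrow> 'a set" and c :: real
  assumes P: "finite P" "\<And>p. p \<in> P \<Longrightarrow> p > 0"
    and c: "0 \<le> c" "c \<le> 1 / 2"
    and E [measurable]: "\<And>p. p \<in> P \<Longrightarrow> E p \<in> events"
    and upper: "\<And>p. p \<in> P \<Longrightarrow> prob (E p) \<le> 2 * c / real p"
    and lower: "\<And>p. p \<in> P \<Longrightarrow> 2 * c / real p - 2 * c / real p ^ 2 \<le> prob (E p)"
    and pair: "\<And>p q. p \<in> P \<Longrightarrow> q \<in> P \<Longrightarrow> q < p \<Longrightarrow>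
      prob (E p \<inter> E q) \<le> 4 * c ^ 2 / (real p * real q) + 2 / real p ^ 2"
    and squares: "(\<Sum>p\<in>P. 1 / real p ^ 2) \<le> 2"
  defines "D \<equiv> \<lambda>w. (\<Sum>p\<in>P. indicator (E p) w) - 2 * c * (\<Sum>p\<in>P. 1 / real p)"
  shows "integrable M (\<lambda>w. (D w)\<^sup>2)"
    and "expectation (\<lambda>w. (D w)\<^sup>2) \<le> 9 * (\<Sum>p\<in>P. 1 / real p)"
proof -
  define L where "L = (\<Sum>p\<in>P. 1 / real p)"
  define m where "m = 2 * c * L"
  define T where "T = (\<lambda>w. \<Sum>p\<in>P. indicator (E p) w :: real)"
  have L0: "L \<ge> 0" unfolding L_def by (intro sum_nonneg) auto
  have "m \<le> 1 * L" unfolding m_def using c L0 by (intro mult_right_mono) auto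
  then have m: "0 \<le> m" "m \<le> L" using c L0 by (auto simp: m_def)
  have D: "(D w)\<^sup>2 = (\<Sum>p\<in>P. \<Sum>q\<in>P. indicator (E p \<inter> E q) w) - 2 * m * T w + m ^ 2" for w
  proof -
    have "T w ^ 2 = (\<Sum>p\<in>P. \<Sum>q\<in>P. indicator (E p \<inter> E q) w)"
      by (simp add: T_def power2_eq_square sum_product indicator_inter_arith)
    then show ?thesis
      by (simp add: D_def m_def T_def L_def power2_diff)
  qed
  have ind: "integrable M (indicat_real A)" if "A \<in> events" for A
    using that by (intro integrable_real_indicator) (auto simp: emeasure_eq_measure)
  have intT: "integrable M T" unfolding T_def
    by (intro Bochner_Integration.integrable_sum ind E)
  have intTT: "integrable M (\<lambda>w. \<Sum>p\<in>P. \<Sum>q\<in>P. indicator (E p \<inter> E q) w :: real)"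
    by (intro Bochner_Integration.integrable_sum ind sets.Int E)
  show "integrable M (\<lambda>w. (D w)\<^sup>2)"
    unfolding D using intT intTT by simp
  have "expectation T = (\<Sum>p\<in>P. prob (E p))"
    unfolding T_def by (subst Bochner_Integration.integral_sum) (auto intro: ind)
  also have "\<dots> \<ge> (\<Sum>p\<in>P. 2 * c / real p - 2 * c / real p ^ 2)"
    by (intro sum_mono lower)
  also have "(\<Sum>p\<in>P. 2 * c / real p - 2 * c / real p ^ 2) = m - 2 * c * (\<Sum>p\<in>P. 1 / real p ^ 2)"
    by (simp add: sum_subtractf m_def L_def sum_distrib_left)
  moreover have "2 * c * (\<Sum>p\<in>P. 1 / real p ^ 2) \<le> 2 * c * 2"
    using c squares by (intro mult_left_mono) auto
  ultimately have ET: "expectation T \<ge> m - 2" using c by linarith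
  \<comment> \<open>The error for a pair depends on its larger member only, so both
    \<open>?s p q\<close> and \<open>?s q p\<close> enter the symmetric bound. The diagonal is
    covered by the separate term \<open>2 * c / p\<close>.\<close>
  let ?s = "\<lambda>p q. if q \<le> p then 2 / real p ^ 2 else 0"
  have bound: "prob (E p \<inter> E q) \<le>
      4 * c ^ 2 / (real p * real q) + ?s p q + ?s q p + (if p = q then 2 * c / real p else 0)"
    if "p \<in> P" "q \<in> P" for p q
  proof -
    consider "p = q" | "q < p" | "p < q" by linarith
    then show ?thesis
    proof cases
      case 1
      then show ?thesis using upper[OF that(1)] by (auto intro!: add_increasing)
    next
      case 2
      then show ?thesis using pair[OF that] by simp
    next
      case 3
      then show ?thesis using pair[OF that(2,1)] by (simp add: Int_commute mult.commute)
    qed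
  qed
  \<comment> \<open>At most \<open>p\<close> elements of \<open>P\<close> are
    \<open>\<le> p\<close>, and each contributes \<open>2 / p^2\<close>.\<close>
  have row: "(\<Sum>q\<in>P. ?s p q) \<le> 2 * (1 / real p)" if "p \<in> P" for p
  proof -
    have "(\<Sum>q\<in>P. ?s p q) = (\<Sum>q\<in>{q \<in> P. q \<le> p}. 2 / real p ^ 2)"
      by (rule sum.inter_filter[OF P(1), symmetric])
    also have "\<dots> = real (card {q \<in> P. q \<le> p}) * (2 / real p ^ 2)" by simp
    also have "\<dots> \<le> real (card {1..p}) * (2 / real p ^ 2)"
    proof -
      have "card {q \<in> P. q \<le> p} \<le> card {1..p}"
        using P by (intro card_mono) (auto simp: Suc_le_eq)
      then show ?thesis by (intro mult_right_mono of_nat_mono) auto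
    qed
    also have "\<dots> = 2 * (1 / real p)" using P(2)[OF that] by (simp add: power2_eq_square)
    finally show ?thesis .
  qed
  have rows: "(\<Sum>p\<in>P. \<Sum>q\<in>P. ?s p q) \<le> 2 * L"
    unfolding L_def sum_distrib_left by (intro sum_mono row)
  have "expectation (\<lambda>w. \<Sum>p\<in>P. \<Sum>q\<in>P. indicator (E p \<inter> E q) w) =
      (\<Sum>p\<in>P. \<Sum>q\<in>P. prob (E p \<inter> E q))"
    by (simp add: Bochner_Integration.integral_sum Bochner_Integration.integrable_sum ind)
  also have "\<dots> \<le> (\<Sum>p\<in>P. \<Sum>q\<in>P.
      4 * c ^ 2 / (real p * real q) + ?s p q + ?s q p + (if p = q then 2 * c / real p else 0))"
    by (intro sum_mono bound)
  also have "\<dots> = (\<Sum>p\<in>P. \<Sum>q\<in>P. 4 * c ^ 2 / (real p * real q)) + (\<Sum>p\<in>P. \<Sum>q\<in>P. ?s p q) +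
      (\<Sum>p\<in>P. \<Sum>q\<in>P. ?s q p) + (\<Sum>p\<in>P. \<Sum>q\<in>P. if p = q then 2 * c / real p else 0)"
    by (simp only: sum.distrib)
  also have "(\<Sum>p\<in>P. \<Sum>q\<in>P. ?s q p) = (\<Sum>p\<in>P. \<Sum>q\<in>P. ?s p q)"
    by (rule sum.swap)
  also have "(\<Sum>p\<in>P. \<Sum>q\<in>P. if p = q then 2 * c / real p else 0) = m"
    using P by (simp add: m_def L_def sum_distrib_left)
  also have "(\<Sum>p\<in>P. \<Sum>q\<in>P. 4 * c ^ 2 / (real p * real q)) = m ^ 2"
    by (simp add: m_def L_def power2_eq_square sum_product sum_distrib_left mult_ac)
  finally have ETT: "expectation (\<lambda>w. \<Sum>p\<in>P. \<Sum>q\<in>P. indicator (E p \<inter> E q) w) \<le> m\<^sup>2 + 5 * L"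
    using rows m by linarith
  have "expectation (\<lambda>w. (D w)\<^sup>2) =
      expectation (\<lambda>w. \<Sum>p\<in>P. \<Sum>q\<in>P. indicator (E p \<inter> E q) w) - 2 * m * expectation T + m ^ 2"
    unfolding D using intT intTT by (simp add: prob_space)
  also have "\<dots> \<le> m\<^sup>2 + 5 * L - 2 * m * (m - 2) + m ^ 2"
    using ETT ET m by (intro add_mono diff_mono mult_left_mono) auto
  also have "\<dots> \<le> 9 * L" using m by (simp add: algebra_simps power2_eq_square)
  finally show "expectation (\<lambda>w. (D w)\<^sup>2) \<le> 9 * (\<Sum>p\<in>P. 1 / real p)" by (simp add: L_def)
qed

subsection \<open>Hitting probabilities on the product space\<close>

definition unit_lebesgue :: "real measure" where
  "unit_lebesgue = uniform_measure lborel {0..1}"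

lemma sets_unit_lebesgue [simp, measurable_cong]: "sets unit_lebesgue = sets borel"
  by (simp add: unit_lebesgue_def)

lemma space_unit_lebesgue [simp]: "space unit_lebesgue = UNIV"
  by (simp add: unit_lebesgue_def)

abbreviation Omega_times_unit :: "((nat \<Rightarrow> int) \<times> real) measure" where
  "Omega_times_unit \<equiv> Omega_measure \<Otimes>\<^sub>M unit_lebesgue"

definition near :: "real \<Rightarrow> nat \<Rightarrow> int \<Rightarrow> real set" where
  "near c p u = {x. \<bar>x - real_of_int u / real p\<bar> \<le> c / real p}"

lemma near_eq: "near c p u = {real_of_int u / real p - c / real p .. real_of_int u / real p + c / real p}"
  by (auto simp: near_def abs_le_iff)

definition hit :: "real \<Rightarrow> nat \<Rightarrow> ((nat \<Rightarrow> int) \<times> real) set" where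
  "hit c p = {w \<in> space Omega_times_unit. snd w \<in> near c p (fst w p)}"

interpretation unit: prob_space unit_lebesgue
  unfolding unit_lebesgue_def by (rule prob_space_uniform_measure) auto

interpretation Omega: prob_space Omega_measure
  by (rule prob_space_Omega_measure)

interpretation OU: pair_prob_space Omega_measure unit_lebesgue ..

lemma measure_unit_lebesgue:
  "A \<in> sets borel \<Longrightarrow> measure unit_lebesgue A = measure lborel ({0..1} \<inter> A)"
  unfolding unit_lebesgue_def by (subst measure_uniform_measure) auto

lemma near_sets: "near c p u \<in> sets borel"
  by (simp add: near_eq)

lemma measure_subset_near_le:
  assumes "A \<subseteq> near c p u" "A \<in> sets borel" "c \<ge> 0"
  shows "measure unit_lebesgue A \<le> 2 * c / real p"
proof -
  have "measure lborel ({0..1} \<inter> A) \<le> measure lborel (near c p u)"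
    using assms by (intro measure_mono_fmeasurable) (auto simp: fmeasurable_def near_eq)
  then show ?thesis using assms by (simp add: measure_unit_lebesgue near_eq)
qed

text \<open>Independence and uniformity of the coordinates enter through this formula, applied with
  \<open>J\<close> consisting of one or two primes.\<close>

lemma Omega_cylinder:
  assumes "J \<subseteq> {p. prime p}" "finite J" "\<And>p. p \<in> J \<Longrightarrow> 0 \<le> v p \<and> v p < int p"
  shows "{a \<in> space Omega_measure. \<forall>p\<in>J. a p = v p} \<in> sets Omega_measure"
    and "measure Omega_measure {a \<in> space Omega_measure. \<forall>p\<in>J. a p = v p} = (\<Prod>p\<in>J. 1 / real p)"
proof -
  \<comment> \<open>The locale \<open>product_prob_space\<close> wants every factor to be a probability space, also at non-primes.\<close>
  define N where "N = (\<lambda>p::nat. uniform_count_measure (if prime p then {0..<int p} else {0}))"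
  have Om: "Omega_measure = PiM {p. prime p} N"
    unfolding Omega_measure_def by (intro PiM_cong) (auto simp: N_def)
  have "prob_space (N p)" for p
    unfolding N_def by (intro prob_space_uniform_count_measure) (auto simp: prime_gt_0_nat)
  then interpret N: product_prob_space N "{p. prime p}"
    unfolding product_prob_space_def product_prob_space_axioms_def product_sigma_finite_def
    by (auto intro: prob_space_imp_sigma_finite)
  have s: "{v p} \<in> sets (N p)" if "p \<in> J" for p
    using assms that by (auto simp: N_def sets_uniform_count_measure)
  have m: "emeasure (N p) {v p} = ennreal (1 / real p)" if "p \<in> J" for p
    using assms that
    by (subst N_def, subst emeasure_uniform_count_measure) auto
  have "{a \<in> space Omega_measure. \<forall>p\<in>J. a p \<in> {v p}} \<in> sets Omega_measure"
    unfolding Om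
  proof (intro sets.sets_Collect_finite_All assms)
    fix p assume p: "p \<in> J"
    then have "p \<in> {p. prime p}" using assms by auto
    then have "(\<lambda>a. a p) \<in> PiM {p. prime p} N \<rightarrow>\<^sub>M N p" by (rule measurable_component_singleton)
    from measurable_sets[OF this s[OF p]]
    show "{a \<in> space (PiM {p. prime p} N). a p \<in> {v p}} \<in> sets (PiM {p. prime p} N)"
      by (simp add: vimage_def Int_def conj_commute)
  qed
  then show "{a \<in> space Omega_measure. \<forall>p\<in>J. a p = v p} \<in> sets Omega_measure" by simp
  have "emeasure Omega_measure {a \<in> space Omega_measure. \<forall>p\<in>J. a p \<in> {v p}} = (\<Prod>p\<in>J. ennreal (1 / real p))"
    unfolding Om using N.emeasure_PiM_Collect[OF assms(1,2), of "\<lambda>p. {v p}"] s m by simp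
  also have "\<dots> = ennreal (\<Prod>p\<in>J. 1 / real p)" by (intro prod_ennreal) auto
  finally show "measure Omega_measure {a \<in> space Omega_measure. \<forall>p\<in>J. a p = v p} = (\<Prod>p\<in>J. 1 / real p)"
    by (simp add: measure_def prod_nonneg)
qed

lemma measure_cylinder_Times:
  assumes "J \<subseteq> {p. prime p}" "finite J" "\<And>p. p \<in> J \<Longrightarrow> 0 \<le> v p \<and> v p < int p" "B \<in> sets borel"
  shows "{a \<in> space Omega_measure. \<forall>p\<in>J. a p = v p} \<times> B \<in> sets Omega_times_unit"
    and "measure Omega_times_unit ({a \<in> space Omega_measure. \<forall>p\<in>J. a p = v p} \<times> B) =
      (\<Prod>p\<in>J. 1 / real p) * measure unit_lebesgue B"
proof -
  have B: "B \<in> sets unit_lebesgue" using assms(4) by simp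
  note O = Omega_cylinder[OF assms(1,2,3)]
  show "{a \<in> space Omega_measure. \<forall>p\<in>J. a p = v p} \<times> B \<in> sets Omega_times_unit"
    by (intro pair_measureI O(1) B)
  have "measure Omega_times_unit ({a \<in> space Omega_measure. \<forall>p\<in>J. a p = v p} \<times> B) =
      measure Omega_measure {a \<in> space Omega_measure. \<forall>p\<in>J. a p = v p} * measure unit_lebesgue B"
    by (simp only: measure_def unit.emeasure_pair_measure_Times[OF O(1) B] enn2real_mult)
  then show "measure Omega_times_unit ({a \<in> space Omega_measure. \<forall>p\<in>J. a p = v p} \<times> B) =
      (\<Prod>p\<in>J. 1 / real p) * measure unit_lebesgue B"
    by (simp only: O(2))
qed

text \<open>Splitting by the value of \<open>a p\<close> makes the event a finite union of products
  of a cylinder and an interval, whose measures are explicit.\<close>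

lemma hit_eq:
  assumes "prime p"
  shows "hit c p = (\<Union>u\<in>{0..<int p}. {a \<in> space Omega_measure. a p = u} \<times> near c p u)"
proof -
  have "a p \<in> {0..<int p}" if "a \<in> space Omega_measure" for a
    using that assms unfolding space_Omega_measure by (auto dest: PiE_mem[where x = p])
  then show ?thesis by (auto simp: hit_def space_pair_measure)
qed

lemma hit_sets:
  assumes "prime p"
  shows "hit c p \<in> sets Omega_times_unit"
  unfolding hit_eq[OF assms] using assms
  by (intro sets.finite_UN) (auto intro!: measure_cylinder_Times(1)[where J = "{p}" and v = "\<lambda>_. u" for u, simplified] near_sets)

lemma prob_hit:
  assumes "prime p"
  shows "measure Omega_times_unit (hit c p) = (\<Sum>u\<in>{0..<int p}. measure unit_lebesgue (near c p u)) / real p"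
proof -
  note C = measure_cylinder_Times[where J = "{p}" and v = "\<lambda>_. u" for u, simplified, OF assms]
  have "measure Omega_times_unit (hit c p) =
      (\<Sum>u\<in>{0..<int p}. measure Omega_times_unit ({a \<in> space Omega_measure. a p = u} \<times> near c p u))"
    unfolding hit_eq[OF assms]
    by (intro OU.P.finite_measure_finite_Union)
       (auto simp: disjoint_family_on_def intro!: C near_sets)
  also have "\<dots> = (\<Sum>u\<in>{0..<int p}. measure unit_lebesgue (near c p u) / real p)"
    by (intro sum.cong refl) (subst C(2), auto simp: near_sets)
  finally show ?thesis by (simp add: sum_divide_distrib)
qed

lemma prob_hit_le:
  assumes "prime p" "c \<ge> 0"
  shows "measure Omega_times_unit (hit c p) \<le> 2 * c / real p"
proof -
  have p: "p > 0" using assms by (simp add: prime_gt_0_nat)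
  have "measure unit_lebesgue (near c p u) \<le> 2 * c / real p" for u
    using measure_subset_near_le[OF subset_refl near_sets assms(2)] .
  then have "(\<Sum>u\<in>{0..<int p}. measure unit_lebesgue (near c p u)) \<le> (\<Sum>u\<in>{0..<int p}. 2 * c / real p)"
    by (intro sum_mono)
  also have "\<dots> = 2 * c" using p by simp
  finally show ?thesis unfolding prob_hit[OF assms(1)] by (intro divide_right_mono) auto
qed

text \<open>Only the interval around \<open>u = 0\<close> sticks out of the unit interval.\<close>

lemma prob_hit_ge:
  assumes "prime p" "0 \<le> c" "c \<le> 1"
  shows "2 * c / real p - 2 * c / real p ^ 2 \<le> measure Omega_times_unit (hit c p)"
proof -
  have p: "p \<ge> 1" using assms prime_gt_0_nat[of p] by simp
  have full: "measure unit_lebesgue (near c p u) = 2 * c / real p" if "u \<in> {1..<int p}" for u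
  proof -
    have "c \<le> real_of_int u" "real_of_int u + c \<le> real p" using that assms by auto
    then have "near c p u \<subseteq> {0..1}"
      using p by (auto simp: near_eq field_simps)
    then have "measure unit_lebesgue (near c p u) = measure lborel (near c p u)"
      by (simp add: measure_unit_lebesgue near_sets Int_absorb1)
    also have "\<dots> = 2 * c / real p" using assms by (simp add: near_eq)
    finally show ?thesis .
  qed
  have "2 * c / real p - 2 * c / real p ^ 2 = (real p - 1) * (2 * c / real p) / real p"
    using p by (simp add: field_simps power2_eq_square)
  also have "(real p - 1) * (2 * c / real p) = (\<Sum>u\<in>{1..<int p}. measure unit_lebesgue (near c p u))"
    using p by (simp add: full of_nat_diff)
  also have "\<dots> / real p \<le> (\<Sum>u\<in>{0..<int p}. measure unit_lebesgue (near c p u)) / real p"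
    by (intro divide_right_mono sum_mono2) auto
  finally show ?thesis unfolding prob_hit[OF assms(1)] .
qed

lemma card_int_interval_le:
  fixes a b :: real
  assumes "a \<le> b"
  shows "finite {u::int. a \<le> u \<and> u \<le> b}" "real (card {u::int. a \<le> u \<and> u \<le> b}) \<le> b - a + 1"
proof -
  have "{u::int. a \<le> u \<and> u \<le> b} = {\<lceil>a\<rceil>..\<lfloor>b\<rfloor>}" by (auto simp: ceiling_le_iff le_floor_iff)
  then show "finite {u::int. a \<le> u \<and> u \<le> b}" "real (card {u::int. a \<le> u \<and> u \<le> b}) \<le> b - a + 1"
    using assms by (auto simp: of_nat_nat) linarith+
qed

text \<open>Counting the centres \<open>u / p\<close> in an interval with error at most one is enough here:
  no arithmetic of the pair of primes enters.\<close>

lemma prob_hit_pair_le: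
  assumes pq: "prime p" "prime q" "q < p" and c: "0 \<le> c" "c \<le> 1 / 2"
  shows "measure Omega_times_unit (hit c p \<inter> hit c q) \<le> 4 * c ^ 2 / (real p * real q) + 2 / real p ^ 2"
proof -
  have pos: "p > 0" "q > 0" using pq by (auto simp: prime_gt_0_nat)
  let ?cyl = "\<lambda>(u, v). {a \<in> space Omega_measure. a p = u \<and> a q = v} \<times> (near c p u \<inter> near c q v)"
  let ?I = "{0..<int p} \<times> {0..<int q}"
  have cyl: "?cyl (u, v) \<in> sets Omega_times_unit"
    "measure Omega_times_unit (?cyl (u, v)) =
      measure unit_lebesgue (near c p u \<inter> near c q v) / (real p * real q)"
    if "(u, v) \<in> ?I" for u v
  proof -
    have "0 \<le> (if r = p then u else v) \<and> (if r = p then u else v) < int r" if "r \<in> {p, q}" for r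
      using that \<open>(u, v) \<in> ?I\<close> by (auto split: if_splits)
    note * = measure_cylinder_Times[OF _ _ this sets.Int[OF near_sets near_sets]]
    have cyl_eq: "?cyl (u, v) = {a \<in> space Omega_measure. \<forall>r\<in>{p, q}. a r = (if r = p then u else v)} \<times>
        (near c p u \<inter> near c q v)"
      using pq by auto
    show "?cyl (u, v) \<in> sets Omega_times_unit"
      unfolding cyl_eq using pq by (intro *) auto
    show "measure Omega_times_unit (?cyl (u, v)) =
        measure unit_lebesgue (near c p u \<inter> near c q v) / (real p * real q)"
      unfolding cyl_eq using pq by (subst *(2)) auto
  qed
  have "hit c p \<inter> hit c q = (\<Union>uv\<in>?I. ?cyl uv)"
    unfolding hit_eq[OF pq(1)] hit_eq[OF pq(2)] by auto
  then have "measure Omega_times_unit (hit c p \<inter> hit c q) \<le> (\<Sum>uv\<in>?I. measure Omega_times_unit (?cyl uv))"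
    by (simp only:) (intro OU.P.finite_measure_subadditive_finite; use cyl in fastforce)
  also have "\<dots> = (\<Sum>(u, v)\<in>?I. measure unit_lebesgue (near c p u \<inter> near c q v)) / (real p * real q)"
    unfolding sum_divide_distrib by (intro sum.cong refl) (use cyl in auto)
  also have "(\<Sum>(u, v)\<in>?I. measure unit_lebesgue (near c p u \<inter> near c q v)) =
      (\<Sum>v\<in>{0..<int q}. \<Sum>u\<in>{0..<int p}. measure unit_lebesgue (near c p u \<inter> near c q v))"
    by (subst sum.swap) (simp add: sum.cartesian_product)
  also have "\<dots> \<le> (\<Sum>v\<in>{0..<int q}. 4 * c ^ 2 / real q + 2 / real p)"
  proof (rule sum_mono)
    fix v assume "v \<in> {0..<int q}"
    \<comment> \<open>Both are scaled by \<open>p\<close>: if the intervals around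
      \<open>u / p\<close> and \<open>v / q\<close> meet, then \<open>u\<close> differs from
      \<open>y\<close> by at most \<open>p * (c / p + c / q) = r\<close>.\<close>
    define y where "y = real p * (real_of_int v / real q)"
    define r where "r = c + c * real p / real q"
    let ?U = "{u::int. y - r \<le> u \<and> u \<le> y + r}"
    have r0: "r \<ge> 0" using c by (simp add: r_def)
    note U = card_int_interval_le[of "y - r" "y + r"]
    have empty: "near c p u \<inter> near c q v = {}" if "u \<notin> ?U" for u
    proof (rule ccontr)
      assume "near c p u \<inter> near c q v \<noteq> {}"
      then obtain x where "\<bar>x - real_of_int u / real p\<bar> \<le> c / real p"
        "\<bar>x - real_of_int v / real q\<bar> \<le> c / real q" by (auto simp: near_def)
      then have "\<bar>real_of_int u / real p - real_of_int v / real q\<bar> \<le> c / real p + c / real q"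
        by linarith
      then have "real p * \<bar>real_of_int u / real p - real_of_int v / real q\<bar> \<le> real p * (c / real p + c / real q)"
        by (intro mult_left_mono) auto
      also have "real p * \<bar>real_of_int u / real p - real_of_int v / real q\<bar> =
          \<bar>real p * (real_of_int u / real p - real_of_int v / real q)\<bar>"
        by (simp add: abs_mult)
      also have "real p * (real_of_int u / real p - real_of_int v / real q) = real_of_int u - y"
        using pos by (simp add: y_def right_diff_distrib)
      also have "real p * (c / real p + c / real q) = r"
        using pos by (simp add: r_def distrib_left)
      finally have "u \<in> ?U" by (auto simp: abs_le_iff)
      with that show False ..
    qed
    have "(\<Sum>u\<in>{0..<int p}. measure unit_lebesgue (near c p u \<inter> near c q v)) =
        (\<Sum>u\<in>{0..<int p} \<inter> ?U. measure unit_lebesgue (near c p u \<inter> near c q v))"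
      by (intro sum.mono_neutral_right) (auto simp: empty)
    also have "\<dots> \<le> (\<Sum>u\<in>{0..<int p} \<inter> ?U. 2 * c / real p)"
      by (intro sum_mono measure_subset_near_le sets.Int near_sets c) auto
    also have "\<dots> = real (card ({0..<int p} \<inter> ?U)) * (2 * c / real p)" by simp
    also have "\<dots> \<le> real (card ?U) * (2 * c / real p)"
      using c U(1) r0 by (intro mult_right_mono of_nat_mono card_mono) auto
    also have "\<dots> \<le> (2 * r + 1) * (2 * c / real p)"
      using c U(2) r0 by (intro mult_right_mono) auto
    \<comment> \<open>The main term comes from the part \<open>2 * c * p / q\<close> of
      \<open>2 * r\<close>. The remaining \<open>2 * c + 1\<close>, of which 1 is the counting
      error, gives the error term.\<close>
    also have "\<dots> = 4 * c ^ 2 / real q + (2 * c) * (2 * c + 1) / real p"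
      using pos by (simp add: r_def field_simps power2_eq_square)
    also have "(2 * c) * (2 * c + 1) \<le> 1 * 2"
      using c by (intro mult_mono) auto
    finally show "(\<Sum>u\<in>{0..<int p}. measure unit_lebesgue (near c p u \<inter> near c q v)) \<le> 4 * c ^ 2 / real q + 2 / real p"
      by (simp add: divide_right_mono)
  qed
  \<comment> \<open>There are \<open>q\<close> values of \<open>v\<close>. The factor
    \<open>q\<close> cancels against the probability \<open>1 / (p * q)\<close> of a pair of values,
    which leaves an error \<open>2 / p^2\<close>.\<close>
  also have "\<dots> = 4 * c ^ 2 + 2 * real q / real p" using pos by (simp add: field_simps)
  also have "(4 * c ^ 2 + 2 * real q / real p) / (real p * real q) = 4 * c ^ 2 / (real p * real q) + 2 / real p ^ 2"
    using pos by (simp add: field_simps power2_eq_square)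
  finally show ?thesis by (simp add: divide_right_mono)
qed

section \<open>Almost sure asymptotics of the number of hits\<close>

lemma AE_hit_count:
  assumes c: "0 \<le> c" "c \<le> 1 / 2"
  shows "AE w in Omega_times_unit.
    ((\<lambda>X. (\<Sum>p | prime p \<and> real p \<le> X. indicat_real (hit c p) w) / ln (ln X)) \<longlongrightarrow> 2 * c) at_top"
proof -
  let ?P = "\<lambda>X. {p::nat. prime p \<and> real p \<le> X}"
  let ?X = "\<lambda>k::nat. exp (exp (real k ^ 2))"
  define T where "T = (\<lambda>X w. \<Sum>p\<in>?P X. indicat_real (hit c p) w)"
  define Z where "Z = (\<lambda>k w. (T (?X k) w - 2 * c * prime_recip_sum (?X k)) / real k ^ 2)"
  note second_moment = OU.P.second_moment_count_le[OF finite_primes_le _ c, of X "hit c" for X,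
      OF _ hit_sets prob_hit_le prob_hit_ge prob_hit_pair_le sum_inverse_squares_le[OF finite_primes_le],
      folded prime_recip_sum_def]
  have moment: "integrable Omega_times_unit (\<lambda>w. (T X w - 2 * c * prime_recip_sum X)\<^sup>2)"
    "(\<integral>w. (T X w - 2 * c * prime_recip_sum X)\<^sup>2 \<partial>Omega_times_unit) \<le> 9 * prime_recip_sum X" for X
    unfolding T_def by (rule second_moment; use c in \<open>auto simp: prime_gt_0_nat\<close>)+
  have X: "filterlim ?X at_top sequentially" by real_asymp
  have R: "(\<lambda>k. prime_recip_sum (?X k) / real k ^ 2) \<longlonglongrightarrow> 1"
    using filterlim_compose[OF prime_recip_sum_asymp X] by simp
  have "AE w in Omega_times_unit. (\<lambda>k. Z k w) \<longlonglongrightarrow> 0"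
  proof (rule AE_tendsto_0_of_summable_second_moments)
    show "integrable Omega_times_unit (\<lambda>w. (Z k w)\<^sup>2)" for k
      unfolding Z_def power_divide by (intro integrable_divide_zero moment)
    \<comment> \<open>The convergent quotients are bounded by some \<open>K\<close>, so the second
      moment of \<open>Z k\<close>, at most \<open>9 * prime_recip_sum (?X k) / k^4\<close>, is at
      most \<open>9 * K / k^2\<close>.\<close>
    obtain K where K: "\<And>k. norm (prime_recip_sum (?X k) / real k ^ 2) \<le> K"
      using convergent_imp_Bseq[OF convergentI[OF R]] unfolding Bseq_def by blast
    show "summable (\<lambda>k. \<integral>w. (Z k w)\<^sup>2 \<partial>Omega_times_unit)"
    proof (rule summable_comparison_test')
      show "summable (\<lambda>k. 9 * K * inverse (real k ^ 2))"
        by (intro summable_mult inverse_power_summable) auto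
      fix k :: nat
      have "norm (\<integral>w. (Z k w)\<^sup>2 \<partial>Omega_times_unit) = (\<integral>w. (Z k w)\<^sup>2 \<partial>Omega_times_unit)"
        by (simp add: integral_nonneg_AE)
      also have "\<dots> = (\<integral>w. (T (?X k) w - 2 * c * prime_recip_sum (?X k))\<^sup>2 \<partial>Omega_times_unit) / (real k ^ 2)\<^sup>2"
        by (simp add: Z_def power_divide)
      also have "\<dots> \<le> 9 * prime_recip_sum (?X k) / (real k ^ 2)\<^sup>2"
        by (intro divide_right_mono moment) auto
      \<comment> \<open>At \<open>k = 0\<close> both sides are 0 by the convention on division by
        zero.\<close>
      also have "\<dots> = 9 * (prime_recip_sum (?X k) / real k ^ 2) * inverse (real k ^ 2)"
        by (simp add: field_simps power2_eq_square)
      also have "\<dots> \<le> 9 * K * inverse (real k ^ 2)"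
        using order_trans[OF abs_ge_self K[of k, unfolded real_norm_def]]
        by (intro mult_right_mono mult_left_mono) auto
      finally show "norm (\<integral>w. (Z k w)\<^sup>2 \<partial>Omega_times_unit) \<le> 9 * K * inverse (real k ^ 2)" .
    qed
  qed
  then show ?thesis
  proof eventually_elim
    case (elim w)
    have "(\<lambda>k. Z k w + 2 * c * (prime_recip_sum (?X k) / real k ^ 2)) \<longlonglongrightarrow> 0 + 2 * c * 1"
      by (intro tendsto_add tendsto_mult_left elim R)
    then have "(\<lambda>k. T (?X k) w / real k ^ 2) \<longlonglongrightarrow> 2 * c"
      by (simp add: Z_def diff_divide_distrib)
    moreover have "mono (\<lambda>X. T X w)"
      unfolding T_def by (intro monoI sum_mono2 finite_primes_le) auto
    moreover have "T X w \<ge> 0" for X unfolding T_def by (intro sum_nonneg) auto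
    ultimately have "((\<lambda>X. T X w / ln (ln X)) \<longlongrightarrow> 2 * c) at_top"
      by (rule tendsto_ln_ln_of_subsequence[rotated 2])
    then show ?case by (simp add: T_def)
  qed
qed

section \<open>From rational to real \<open>c\<close>, and from pairs to almost every tuple\<close>

abbreviation (input) near_count :: "(nat \<Rightarrow> int) \<Rightarrow> real \<Rightarrow> real \<Rightarrow> real \<Rightarrow> real" where
  "near_count a c x X \<equiv> real (card {p::nat. prime p \<and> real p \<le> X \<and>
     \<bar>x - real_of_int (a p) / real p\<bar> \<le> c / real p})"

lemma sum_indicator_hit:
  assumes "a \<in> space Omega_measure"
  shows "(\<Sum>p | prime p \<and> real p \<le> X. indicat_real (hit c p) (a, x)) = near_count a c x X"
proof -
  have "(\<Sum>p | prime p \<and> real p \<le> X. indicat_real (hit c p) (a, x)) =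
      (\<Sum>p | prime p \<and> real p \<le> X. if \<bar>x - real_of_int (a p) / real p\<bar> \<le> c / real p then 1 else 0)"
    using assms by (intro sum.cong) (auto simp: indicator_def hit_def near_def space_pair_measure)
  also have "\<dots> = near_count a c x X"
    by (simp add: sum.inter_filter[OF finite_primes_le, symmetric] conj_assoc)
  finally show ?thesis .
qed

lemma near_count_mono:
  assumes "c \<le> c'"
  shows "near_count a c x X \<le> near_count a c' x X"
proof -
  have "finite {p::nat. prime p \<and> real p \<le> X \<and> \<bar>x - real_of_int (a p) / real p\<bar> \<le> c' / real p}"
    by (rule finite_subset[OF _ finite_primes_le[of X]]) auto
  moreover have "c / real p \<le> c' / real p" for p :: nat
    using assms by (intro divide_right_mono) auto
  ultimately show ?thesis
    by (intro of_nat_mono card_mono) (auto intro: order_trans)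
qed

text \<open>The count increases with \<open>c\<close>, so the limits at rational \<open>r\<close>
  slightly below and slightly above \<open>c\<close> squeeze the quotient at
  \<open>c\<close>.\<close>

lemma near_count_asymp:
  assumes rat: "\<And>r. r \<in> \<rat> \<Longrightarrow> 0 < r \<Longrightarrow> r < 1 / 2 \<Longrightarrow>
      ((\<lambda>X. near_count a r x X / ln (ln X)) \<longlongrightarrow> 2 * r) at_top"
    and c: "0 < c" "c < 1 / 2"
  shows "(\<lambda>X. near_count a c x X) \<sim>[at_top] (\<lambda>X. 2 * c * ln (ln X))"
proof -
  have ev: "eventually (\<lambda>X::real. ln (ln X) > 0) at_top" by real_asymp
  have "((\<lambda>X. near_count a c x X / ln (ln X)) \<longlongrightarrow> 2 * c) at_top"
  proof (rule order_tendstoI)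
    fix l assume "l < 2 * c"
    \<comment> \<open>A rational \<open>r\<close> above \<open>l / 2\<close> has limit
      \<open>2 * r > l\<close>, and the maximum with 0 keeps \<open>r\<close> in the range of
      \<open>rat\<close>. The minimum with \<open>1 / 2\<close> serves the same purpose in the upper
      bound.\<close>
    then have "max 0 (l / 2) < c" using c by auto
    then obtain r where r: "r \<in> \<rat>" "max 0 (l / 2) < r" "r < c"
      using Rats_dense_in_real by blast
    have "eventually (\<lambda>X. l < near_count a r x X / ln (ln X)) at_top"
      using r c by (intro order_tendstoD(1)[OF rat]) auto
    with ev show "eventually (\<lambda>X. l < near_count a c x X / ln (ln X)) at_top"
    proof eventually_elim
      case (elim X)
      have "near_count a r x X / ln (ln X) \<le> near_count a c x X / ln (ln X)"
        using elim r by (intro divide_right_mono near_count_mono) linarith+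
      with elim(2) show ?case by (rule less_le_trans)
    qed
  next
    fix l assume "2 * c < l"
    then have "c < min (1 / 2) (l / 2)" using c by auto
    then obtain r where r: "r \<in> \<rat>" "c < r" "r < min (1 / 2) (l / 2)"
      using Rats_dense_in_real by blast
    have "eventually (\<lambda>X. near_count a r x X / ln (ln X) < l) at_top"
      using r c by (intro order_tendstoD(2)[OF rat]) auto
    with ev show "eventually (\<lambda>X. near_count a c x X / ln (ln X) < l) at_top"
    proof eventually_elim
      case (elim X)
      have "near_count a c x X / ln (ln X) \<le> near_count a r x X / ln (ln X)"
        using elim r by (intro divide_right_mono near_count_mono) linarith+
      then show ?case using elim(2) by (rule le_less_trans)
    qed
  qed
  then have "((\<lambda>X. near_count a c x X / ln (ln X) / (2 * c)) \<longlongrightarrow> 2 * c / (2 * c)) at_top"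
    by (intro tendsto_divide tendsto_const) (use c in auto)
  then show ?thesis
    using c by (intro asymp_equivI') (simp add: mult.commute)
qed

theorem corollary1p2:
  "AE a in Omega_measure.
     \<exists>S. S \<subseteq> {0..1::real} \<and> S \<in> sets lebesgue \<and> emeasure lebesgue S = 1 \<and>
       (\<forall>c x. 0 < c \<and> c < 1 / 2 \<and> x \<in> S \<longrightarrow>
          (\<lambda>X::real. real (card {p::nat. prime p \<and> real p \<le> X \<and>
                 \<bar>x - real_of_int (a p) / real p\<bar> \<le> c / real p}))
            \<sim>[at_top] (\<lambda>X. 2 * c * ln (ln X)))"
proof -
  let ?R = "{r \<in> \<rat>. 0 < r \<and> r < 1 / 2} :: real set"
  have "countable ?R" by (rule countable_subset[OF _ countable_rat]) auto
  \<comment> \<open>Only countably many exceptional null sets are united, one for each rational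
    \<open>r\<close>.\<close>
  then have "AE w in Omega_times_unit. \<forall>r\<in>?R.
      ((\<lambda>X. (\<Sum>p | prime p \<and> real p \<le> X. indicat_real (hit r p) w) / ln (ln X)) \<longlongrightarrow> 2 * r) at_top"
    by (subst AE_ball_countable) (auto intro!: AE_hit_count)
  then have "AE a in Omega_measure. AE x in unit_lebesgue. \<forall>r\<in>?R.
      ((\<lambda>X. (\<Sum>p | prime p \<and> real p \<le> X. indicat_real (hit r p) (a, x)) / ln (ln X)) \<longlongrightarrow> 2 * r) at_top"
    by (rule OU.AE_pair)
  with AE_space show ?thesis
  proof eventually_elim
    case (elim a)
    \<comment> \<open>This set depends on \<open>a\<close> but not on \<open>c\<close>, so one set
      \<open>S\<close> serves every \<open>c\<close>.\<close>
    define G where "G = {x. \<forall>r\<in>?R. ((\<lambda>X. near_count a r x X / ln (ln X)) \<longlongrightarrow> 2 * r) at_top}"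
    have "AE x in unit_lebesgue. x \<in> G"
      using elim(2) by (simp add: sum_indicator_hit[OF elim(1)] G_def)
    then have "AE x in lborel. x \<in> {0..1} \<longrightarrow> x \<in> G"
      unfolding unit_lebesgue_def by (subst (asm) AE_uniform_measure) auto
    \<comment> \<open>The points of the unit interval outside \<open>G\<close> are covered by a
      Borel null set \<open>N\<close>. Removing \<open>N\<close> gives a set that is Borel by
      construction, has measure 1 and lies in \<open>G\<close>.\<close>
    then obtain N where N: "N \<in> null_sets lborel" "{x. \<not> (x \<in> {0..1} \<longrightarrow> x \<in> G)} \<subseteq> N"
      unfolding eventually_ae_filter space_lborel space_borel by auto
    let ?S = "{0..1} - N"
    have "?S \<in> sets borel" using N(1) by auto
    moreover have "emeasure lborel ?S = 1"
      using emeasure_Diff_null_set[OF N(1), of "{0..1}"] by simp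
    ultimately have "?S \<in> sets lebesgue" "emeasure lebesgue ?S = 1"
      by (auto intro: sets_completionI_sets)
    moreover have "(\<lambda>X. near_count a c x X) \<sim>[at_top] (\<lambda>X. 2 * c * ln (ln X))"
      if "0 < c \<and> c < 1 / 2 \<and> x \<in> ?S" for c x
    proof -
      have "x \<in> G" using that N(2) by auto
      then show ?thesis using that by (intro near_count_asymp) (auto simp: G_def)
    qed
    ultimately show ?case by (intro exI[of _ ?S]) auto
  qed
qed

end
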